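(* Let $n\ge1$ and let $\Gamma$, $T$, $\Gamma_0,\Gamma_1$ be as in the context. Every point $p\in\Gamma$ has at most $2^{n(n+1)/2}$ symbolic orbits under $T$.
   Context: $\Gamma=\{(\alpha_1,\ldots,\alpha_n)\in\mathbb{R}^n:0\le\alpha_n\le\cdots\le\alpha_1\le1\}$. The tent map $T:\Gamma\to\Gamma$ is $T(\alpha_1,\ldots,\alpha_n)=(\alpha_1+\alpha_n,\alpha_1-\alpha_n,\alpha_2-\alpha_n,\ldots,\alpha_{n-1}-\alpha_n)$ if $\alpha_1+\alpha_n\le1$, and $(2-\alpha_1-\alpha_n,\alpha_1-\alpha_n,\ldots,\alpha_{n-1}-\alpha_n)$ if $\alpha_1+\alpha_n\ge1$. Let $\Gamma_0=\Gamma\cap\{\alpha_1+\alpha_n\le1\}$ and $\Gamma_1=\Gamma\cap\{\alpha_1+\alpha_n\ge1\}$ (the images of the two inverse branches $\tau_0,\tau_1$ of $T$). A sequence $\mathbf{a}=a_0a_1a_2\ldots\in\{0,1\}^{\mathbb{N}}$ is a symbolic orbit of $p$ if $T^tp\in\Gamma_{a_t}$ for every $t\ge0$. *)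

theory Defs
  imports Complex_Main
begin

text \<open>
  A point of \<open>\<real>\<^sup>n\<close> is a real list of length \<open>n\<close>; the coordinate \<open>\<alpha>\<^sub>i\<close> is \<open>\<alpha> ! (i - 1)\<close>, so
  that \<open>\<alpha>\<^sub>1 = hd \<alpha>\<close> and \<open>\<alpha>\<^sub>n = last \<alpha>\<close>. The definitions are meant for \<open>n \<ge> 1\<close> only, as
  \<open>hd\<close> and \<open>last\<close> are unspecified on the empty list.
\<close>

definition Gamma :: "nat \<Rightarrow> real list set" where
  "Gamma n = {\<alpha>. length \<alpha> = n \<and> 0 \<le> last \<alpha> \<and> sorted_wrt (\<ge>) \<alpha> \<and> hd \<alpha> \<le> 1}"

definition tent :: "real list \<Rightarrow> real list" where
  "tent \<alpha> =
    (if hd \<alpha> + last \<alpha> \<le> 1 then hd \<alpha> + last \<alpha> else 2 - hd \<alpha> - last \<alpha>)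
      # map (\<lambda>x. x - last \<alpha>) (butlast \<alpha>)"

text \<open>The two clauses defining \<open>T\<close> agree on their overlap \<open>\<alpha>\<^sub>1 + \<alpha>\<^sub>n = 1\<close>.\<close>

lemma tent_ge:
  "hd \<alpha> + last \<alpha> \<ge> 1 \<Longrightarrow>
    tent \<alpha> = (2 - hd \<alpha> - last \<alpha>) # map (\<lambda>x. x - last \<alpha>) (butlast \<alpha>)"
  by (simp add: tent_def)

definition Gamma0 :: "nat \<Rightarrow> real list set" where
  "Gamma0 n = Gamma n \<inter> {\<alpha>. hd \<alpha> + last \<alpha> \<le> 1}"

definition Gamma1 :: "nat \<Rightarrow> real list set" where
  "Gamma1 n = Gamma n \<inter> {\<alpha>. hd \<alpha> + last \<alpha> \<ge> 1}"

text \<open>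
  The pieces \<open>\<Gamma>\<^sub>0\<close> and \<open>\<Gamma>\<^sub>1\<close> overlap, so a point whose orbit meets \<open>\<alpha>\<^sub>1 + \<alpha>\<^sub>n = 1\<close>
  has more than one symbolic orbit.
\<close>

definition symbolic_orbit :: "nat \<Rightarrow> real list \<Rightarrow> (nat \<Rightarrow> nat) \<Rightarrow> bool" where
  "symbolic_orbit n p a \<longleftrightarrow>
    (\<forall>t. a t \<in> {0, 1} \<and> (tent ^^ t) p \<in> (if a t = 0 then Gamma0 n else Gamma1 n))"

lemma tent_Gamma:
  assumes "n \<ge> 1" and "\<alpha> \<in> Gamma n"
  shows "tent \<alpha> \<in> Gamma n"
proof -
  have ne: "\<alpha> \<noteq> []" and len: "length \<alpha> = n" and l0: "0 \<le> last \<alpha>"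
    and so: "sorted_wrt (\<ge>) \<alpha>" and h1: "hd \<alpha> \<le> 1"
    using assms by (auto simp: Gamma_def)
  define b where "b = last \<alpha>"
  define bs where "bs = butlast \<alpha>"
  have al: "\<alpha> = bs @ [b]" using ne by (simp add: b_def bs_def)
  have b0: "0 \<le> b" using l0 by (simp add: b_def)
  have so': "sorted_wrt (\<ge>) bs" and ge: "\<And>x. x \<in> set bs \<Longrightarrow> b \<le> x"
    using so unfolding al by (auto simp: sorted_wrt_append)
  show ?thesis
  proof (cases bs)
    case Nil
    then show ?thesis using al len b0 h1 by (simp add: tent_def Gamma_def)
  next
    case (Cons c cs)
    have hd: "hd \<alpha> = c" using al Cons by simp
    have "sorted_wrt (\<ge>) (map (\<lambda>x. x - b) bs)"
      using so' by (simp add: sorted_wrt_map)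
    moreover have "x \<le> c" if "x \<in> set bs" for x
      using so' that Cons by auto
    moreover have "b \<le> c" "b \<le> last bs" using ge Cons by auto
    ultimately show ?thesis
      using al len b0 h1 Cons unfolding tent_def Gamma_def hd
      by (auto simp: last_map split: if_splits) force+
  qed
qed

end

theory Submission imports Defs begin

text \<open>
  Only the visits of the orbit to the wall \<open>\<alpha>\<^sub>1 + \<alpha>\<^sub>n = 1\<close> leave a choice of symbol, so it is
  enough to see that there are at most \<open>n(n+1)/2\<close> of them. Let \<open>S\<close> be the set of facets of the
  simplex \<open>\<Gamma>\<close> that contain the current point, where facet \<open>0\<close> is \<open>\<alpha>\<^sub>1 = 1\<close>, facet \<open>i\<close> is
  \<open>\<alpha>\<^sub>i = \<alpha>\<^sub>i\<^sub>+\<^sub>1\<close>, and facet \<open>n\<close> is \<open>\<alpha>\<^sub>n = 0\<close>. The tent map sends facet \<open>i < n\<close> into facet \<open>i + 1\<close>,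
  facet \<open>n\<close> into facet \<open>1\<close>, and the wall into facet \<open>0\<close>. Hence \<open>|S| \<le> n\<close> never decreases, and it
  grows at a wall visit unless \<open>0, n \<in> S\<close>. As facet \<open>0\<close> is reached only from the wall, a visit of
  this exceptional kind directly follows another visit, and it uses up one element of the run
  \<open>n, n - 1, \<dots>\<close> contained in \<open>S\<close>. So there are at most \<open>k\<close> visits for each value \<open>k\<close> of \<open>|S|\<close> that
  is reached, and \<open>1 + \<dots> + n = n(n+1)/2\<close>.
\<close>

section \<open>The facets through a point\<close>

definition wall :: "real list \<Rightarrow> bool" where
  "wall \<alpha> \<longleftrightarrow> hd \<alpha> + last \<alpha> = 1"

text \<open>Padding with 1 in front and 0 behind turns every facet, also the first and the last,
  into an equality of neighbouring entries.\<close>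

definition facets :: "real list \<Rightarrow> nat set" where
  "facets \<alpha> = {i. i \<le> length \<alpha> \<and> (1 # \<alpha> @ [0]) ! i = (1 # \<alpha> @ [0]) ! Suc i}"

definition final_run :: "nat \<Rightarrow> nat set \<Rightarrow> nat set" where
  "final_run n S = {i \<in> {1..n}. {i..n} \<subseteq> S}"

text \<open>An upper bound for the number of wall visits of the orbit of \<open>\<alpha>\<close>.\<close>

definition potential :: "nat \<Rightarrow> real list \<Rightarrow> nat" where
  "potential n \<alpha> = \<Sum>{card (facets \<alpha>)<..n} +
    (if 0 \<in> facets \<alpha> then card (final_run n (facets \<alpha>)) else 0)"

lemma Gamma_nonempty: "n \<ge> 1 \<Longrightarrow> \<alpha> \<in> Gamma n \<Longrightarrow> \<alpha> \<noteq> []"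
  by (auto simp: Gamma_def)

lemma facets_subset: "\<alpha> \<in> Gamma n \<Longrightarrow> facets \<alpha> \<subseteq> {0..n}"
  by (auto simp: facets_def Gamma_def)

lemma finite_facets: "finite (facets \<alpha>)"
  by (simp add: facets_def)

lemma facets_0: "\<alpha> \<noteq> [] \<Longrightarrow> 0 \<in> facets \<alpha> \<longleftrightarrow> hd \<alpha> = 1"
  by (cases \<alpha>) (auto simp: facets_def)

lemma facets_length: "\<alpha> \<noteq> [] \<Longrightarrow> length \<alpha> \<in> facets \<alpha> \<longleftrightarrow> last \<alpha> = 0"
  by (auto simp: facets_def nth_append last_conv_nth nth_Cons')

text \<open>Otherwise the equalities would chain the leading 1 to the trailing 0.\<close>

lemma facets_not_all: "\<not> {0..length \<alpha>} \<subseteq> facets \<alpha>"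
proof
  let ?e = "1 # \<alpha> @ [0]"
  assume all: "{0..length \<alpha>} \<subseteq> facets \<alpha>"
  have "i \<le> Suc (length \<alpha>) \<Longrightarrow> ?e ! i = 1" for i
  proof (induction i)
    case (Suc i)
    then have "i \<in> facets \<alpha>" using all by auto
    then show ?case using Suc by (simp add: facets_def)
  qed simp
  from this[of "Suc (length \<alpha>)"] show False by (simp add: nth_append)
qed

lemma card_facets_le:
  assumes "\<alpha> \<in> Gamma n"
  shows "card (facets \<alpha>) \<le> n"
proof -
  have "facets \<alpha> \<subset> {0..n}"
    using facets_subset[OF assms] facets_not_all[of \<alpha>] assms by (auto simp: Gamma_def)
  then have "card (facets \<alpha>) < card {0..n}" by (intro psubset_card_mono) auto
  then show ?thesis by simp
qed

section \<open>Facets under the tent map\<close>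

lemma tent_extended:
  assumes "\<alpha> \<noteq> []"
  shows "tent \<alpha> @ [0] = hd (tent \<alpha>) # map (\<lambda>x. x - last \<alpha>) \<alpha>"
proof -
  have "map (\<lambda>x. x - last \<alpha>) (butlast \<alpha> @ [last \<alpha>]) = map (\<lambda>x. x - last \<alpha>) (butlast \<alpha>) @ [0]"
    by simp
  then have "map (\<lambda>x. x - last \<alpha>) \<alpha> = map (\<lambda>x. x - last \<alpha>) (butlast \<alpha>) @ [0]"
    using assms by simp
  then show ?thesis by (simp add: tent_def)
qed

lemma length_tent: "\<alpha> \<noteq> [] \<Longrightarrow> length (tent \<alpha>) = length \<alpha>"
  by (simp add: tent_def)

text \<open>By \<open>tent_extended\<close>, the entries of \<open>\<alpha>\<close> reappear one
  place later, all lowered by the same constant, so equalities of neighbours are kept. Only facets 0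
  and 1 involve the new head.\<close>

lemma facets_tent:
  assumes "\<alpha> \<noteq> []"
  shows "0 \<in> facets (tent \<alpha>) \<longleftrightarrow> wall \<alpha>"
    and "Suc 0 \<in> facets (tent \<alpha>) \<longleftrightarrow> hd (tent \<alpha>) = hd \<alpha> - last \<alpha>"
    and "1 \<le> i \<Longrightarrow> i < length \<alpha> \<Longrightarrow> Suc i \<in> facets (tent \<alpha>) \<longleftrightarrow> i \<in> facets \<alpha>"
proof -
  show "0 \<in> facets (tent \<alpha>) \<longleftrightarrow> wall \<alpha>"
    by (auto simp: facets_def tent_def wall_def)
  have len: "length \<alpha> \<ge> 1" using assms by (cases \<alpha>) auto
  show "Suc 0 \<in> facets (tent \<alpha>) \<longleftrightarrow> hd (tent \<alpha>) = hd \<alpha> - last \<alpha>"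
    using len assms
    by (simp add: facets_def tent_extended length_tent hd_conv_nth)
  show "Suc i \<in> facets (tent \<alpha>) \<longleftrightarrow> i \<in> facets \<alpha>" if "1 \<le> i" "i < length \<alpha>"
    using that assms
    by (auto simp: facets_def tent_extended length_tent nth_append nth_Cons')
qed

lemma Suc_facets_tent:
  assumes "n \<ge> 1" "\<alpha> \<in> Gamma n" "i \<in> facets \<alpha>" "i \<noteq> n"
  shows "Suc i \<in> facets (tent \<alpha>)"
proof (cases "i = 0")
  case True
  note ne = Gamma_nonempty[OF assms(1,2)]
  have "hd \<alpha> = 1" "0 \<le> last \<alpha>"
    using True assms facets_0[OF ne] by (auto simp: Gamma_def)
  then show ?thesis
    unfolding True facets_tent(2)[OF ne] by (auto simp: tent_def)
next
  case False
  then show ?thesis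
    using assms facets_tent(3)[OF Gamma_nonempty[OF assms(1,2)], of i] facets_subset[OF assms(2)]
    by (force simp: Gamma_def)
qed

lemma last_facet_tent:
  assumes "n \<ge> 1" "\<alpha> \<in> Gamma n" "n \<in> facets \<alpha>"
  shows "Suc 0 \<in> facets (tent \<alpha>)"
proof -
  note ne = Gamma_nonempty[OF assms(1,2)]
  have "last \<alpha> = 0" "hd \<alpha> \<le> 1"
    using assms facets_length[OF ne] by (auto simp: Gamma_def)
  then show ?thesis
    unfolding facets_tent(2)[OF ne] by (auto simp: tent_def)
qed

lemma wall_facets:
  assumes "n \<ge> 1" "\<alpha> \<in> Gamma n"
  shows "0 \<in> facets \<alpha> \<Longrightarrow> n \<in> facets \<alpha> \<Longrightarrow> wall \<alpha>"
    and "wall \<alpha> \<Longrightarrow> 0 \<in> facets \<alpha> \<longleftrightarrow> n \<in> facets \<alpha>"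
  using assms facets_0[of \<alpha>] facets_length[of \<alpha>] Gamma_nonempty[OF assms]
  by (auto simp: wall_def Gamma_def)

lemma card_facets_tent_mono:
  assumes "n \<ge> 1" "\<alpha> \<in> Gamma n"
  shows "card (facets \<alpha>) \<le> card (facets (tent \<alpha>))"
proof -
  \<comment> \<open>Facets 0 and \<open>n\<close> both move to 1. If both are present, the point is
    on the wall, so the image lies on facet 0, which can serve as the value at
    \<open>n\<close>.\<close>
  define g where "g i = (if i = n then (if 0 \<in> facets \<alpha> then 0 else 1) else Suc i)" for i
  have "g ` facets \<alpha> \<subseteq> facets (tent \<alpha>)"
    using Suc_facets_tent[OF assms] last_facet_tent[OF assms] wall_facets(1)[OF assms]
      facets_tent(1)[OF Gamma_nonempty[OF assms]]
    by (auto simp: g_def)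
  moreover have "inj_on g (facets \<alpha>)"
    by (auto simp: inj_on_def g_def intro: gr0I split: if_splits)
  ultimately show ?thesis
    by (meson card_inj_on_le finite_facets)
qed

lemma card_facets_tent_wall:
  assumes "n \<ge> 1" "\<alpha> \<in> Gamma n" "wall \<alpha>" "0 \<notin> facets \<alpha>"
  shows "card (facets \<alpha>) < card (facets (tent \<alpha>))"
proof -
  have "n \<notin> facets \<alpha>" using wall_facets(2)[OF assms(1-3)] assms(4) by simp
  then have "insert 0 (Suc ` facets \<alpha>) \<subseteq> facets (tent \<alpha>)"
    using Suc_facets_tent[OF assms(1,2)] facets_tent(1)[OF Gamma_nonempty[OF assms(1,2)]] assms(3)
    by auto
  then have "card (insert 0 (Suc ` facets \<alpha>)) \<le> card (facets (tent \<alpha>))"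
    by (intro card_mono finite_facets)
  then show ?thesis by (simp add: finite_facets card_image)
qed

section \<open>Decrease of the potential\<close>

lemma finite_final_run: "finite (final_run n S)"
  by (simp add: final_run_def)

lemma card_final_run_less:
  assumes "finite S" "0 \<in> S"
  shows "card (final_run n S) < card S"
  by (rule psubset_card_mono) (use assms in \<open>auto simp: final_run_def\<close>)

lemma card_final_run_tent:
  assumes "n \<ge> 1" "\<alpha> \<in> Gamma n" "wall \<alpha>" "0 \<in> facets \<alpha>"
  shows "card (final_run n (facets (tent \<alpha>))) < card (final_run n (facets \<alpha>))"
proof -
  note ne = Gamma_nonempty[OF assms(1,2)]
  let ?R = "final_run n (facets (tent \<alpha>))"
  have len: "length \<alpha> = n" using assms by (simp add: Gamma_def)
  have n: "n \<in> facets \<alpha>" using wall_facets(2)[OF assms(1-3)] assms(4) by simp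
  have zero: "0 \<in> facets (tent \<alpha>)" using facets_tent(1)[OF ne] assms(3) by simp
  \<comment> \<open>The new run cannot reach 1: facet 0 is present too, so the image would lie on
    all facets. Hence the run can be pulled back one step, and its pullback misses
    \<open>n\<close>.\<close>
  have shift: "2 \<le> i \<and> i - 1 \<in> final_run n (facets \<alpha>)" if i: "i \<in> ?R" for i
  proof -
    have "i \<noteq> 1"
    proof
      assume "i = 1"
      then have "{0..n} \<subseteq> facets (tent \<alpha>)"
        using i zero by (auto simp: final_run_def) (metis Suc_leI atLeastAtMost_iff gr0I subsetD)
      then show False
        using facets_not_all[of "tent \<alpha>"] length_tent[OF ne] len by simp
    qed
    then have i2: "2 \<le> i" using i by (auto simp: final_run_def)
    have "j \<in> facets \<alpha>" if "i - 1 \<le> j" "j \<le> n" for j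
    proof (cases "j = n")
      case False
      then have "Suc j \<in> facets (tent \<alpha>)" using i that by (auto simp: final_run_def)
      then show ?thesis using facets_tent(3)[OF ne, of j] that i2 False len by simp
    qed (use n in simp)
    then show ?thesis using i i2 by (auto simp: final_run_def)
  qed
  have "card ?R = card ((\<lambda>i. i - 1) ` ?R)"
    by (rule card_image[symmetric]) (use shift in \<open>fastforce simp: inj_on_def\<close>)
  also have "\<dots> < card (final_run n (facets \<alpha>))"
  proof (rule psubset_card_mono[OF finite_final_run])
    have "n \<in> final_run n (facets \<alpha>)" using n assms(1) by (simp add: final_run_def)
    moreover have "n \<notin> (\<lambda>i. i - 1) ` ?R" using assms(1) by (auto simp: final_run_def)
    ultimately show "(\<lambda>i. i - 1) ` ?R \<subset> final_run n (facets \<alpha>)" using shift by auto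
  qed
  finally show ?thesis .
qed

text \<open>The run term is smaller than \<open>card (facets \<alpha>)\<close>, a summand that
  occurs on the right but not in the potential.\<close>

lemma potential_less_sum:
  assumes "k < card (facets \<alpha>)" "card (facets \<alpha>) \<le> n"
  shows "potential n \<alpha> < \<Sum>{k<..n}"
proof -
  let ?k = "card (facets \<alpha>)"
  have "(if 0 \<in> facets \<alpha> then card (final_run n (facets \<alpha>)) else 0) < ?k"
    using card_final_run_less[OF finite_facets, of \<alpha> n] assms by auto
  then have "potential n \<alpha> < \<Sum>(insert ?k {?k<..n})"
    by (simp add: potential_def)
  also have "\<dots> \<le> \<Sum>{k<..n}"
    by (rule sum_mono2) (use assms in auto)
  finally show ?thesis .
qed

text \<open>If the number of facets grows, the sum pays for the visit. If it stays the same, a visit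
  starts on facet 0 and shortens the run; without a visit the image is off facet 0 and has no run
  term.\<close>

lemma potential_tent:
  assumes "n \<ge> 1" "\<alpha> \<in> Gamma n"
  shows "potential n (tent \<alpha>) + of_bool (wall \<alpha>) \<le> potential n \<alpha>"
proof (cases "card (facets \<alpha>) < card (facets (tent \<alpha>))")
  case True
  then have "potential n (tent \<alpha>) < \<Sum>{card (facets \<alpha>)<..n}"
    by (rule potential_less_sum) (rule card_facets_le[OF tent_Gamma[OF assms]])
  also have "\<dots> \<le> potential n \<alpha>" by (simp add: potential_def)
  finally show ?thesis by simp
next
  case False
  then have "card (facets (tent \<alpha>)) = card (facets \<alpha>)"
    using card_facets_tent_mono[OF assms] by simp
  moreover have "0 \<in> facets \<alpha>" if "wall \<alpha>"
    using card_facets_tent_wall[OF assms that] False by blast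
  ultimately show ?thesis
    using card_final_run_tent[OF assms] facets_tent(1)[OF Gamma_nonempty[OF assms]]
    by (auto simp: potential_def Suc_le_eq)
qed

lemma potential_le:
  assumes "\<alpha> \<in> Gamma n"
  shows "potential n \<alpha> \<le> n * (n + 1) div 2"
proof -
  have "potential n \<alpha> \<le> \<Sum>{0..n}"
  proof (cases "card (facets \<alpha>) = 0")
    case True
    then have "facets \<alpha> = {}" by (simp add: finite_facets)
    then show ?thesis by (auto simp: potential_def intro: sum_mono2)
  next
    case False
    then have "potential n \<alpha> < \<Sum>{0<..n}"
      using potential_less_sum[of 0 \<alpha> n] card_facets_le[OF assms] by simp
    also have "\<dots> \<le> \<Sum>{0..n}" by (rule sum_mono2) auto
    finally show ?thesis by simp
  qed
  then show ?thesis using gauss_sum_nat[of n] by simp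
qed

section \<open>Counting wall visits and symbolic orbits\<close>

lemma funpow_tent_Gamma: "n \<ge> 1 \<Longrightarrow> p \<in> Gamma n \<Longrightarrow> (tent ^^ t) p \<in> Gamma n"
  by (induction t) (auto intro: tent_Gamma)

lemma card_wall_visits_before:
  assumes "n \<ge> 1" "p \<in> Gamma n"
  shows "card {t. t < N \<and> wall ((tent ^^ t) p)} + potential n ((tent ^^ N) p) \<le> potential n p"
proof (induction N)
  case (Suc N)
  have "{t. t < Suc N \<and> wall ((tent ^^ t) p)} = {t. t < N \<and> wall ((tent ^^ t) p)} \<union>
      (if wall ((tent ^^ N) p) then {N} else {})"
    by (auto simp: less_Suc_eq)
  then have "card {t. t < Suc N \<and> wall ((tent ^^ t) p)} =
      card {t. t < N \<and> wall ((tent ^^ t) p)} + of_bool (wall ((tent ^^ N) p))"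
    by simp
  then show ?case
    using Suc potential_tent[OF assms(1) funpow_tent_Gamma[OF assms], of N] by simp
qed simp

lemma wall_visits:
  assumes "n \<ge> 1" "p \<in> Gamma n"
  defines "W \<equiv> {t. wall ((tent ^^ t) p)}"
  shows "finite W \<and> card W \<le> n * (n + 1) div 2"
\<comment> \<open>The bound on the visits before time \<open>N\<close> does not depend on
  \<open>N\<close>, and each finite set of visits lies before some \<open>N\<close>.\<close>
proof (rule finite_if_finite_subsets_card_bdd)
  fix F assume F: "F \<subseteq> W" "finite F"
  then obtain N where "F \<subseteq> {..<N}" unfolding finite_nat_set_iff_bounded by blast
  then have "card F \<le> card {t. t < N \<and> wall ((tent ^^ t) p)}"
    using F by (intro card_mono) (auto simp: W_def)
  also have "\<dots> \<le> n * (n + 1) div 2"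
    using card_wall_visits_before[OF assms(1,2), of N] potential_le[OF assms(2)] by linarith
  finally show "card F \<le> n * (n + 1) div 2" .
qed

text \<open>Off the wall, a point lies in only one of the two pieces, which forces the
  symbol.\<close>

lemma symbolic_orbit_eqI:
  assumes a: "symbolic_orbit n p a" and b: "symbolic_orbit n p b"
    and wall: "\<And>t. wall ((tent ^^ t) p) \<Longrightarrow> a t = 0 \<longleftrightarrow> b t = 0"
  shows "a = b"
proof
  fix t
  have "a t \<in> {0, 1}" "b t \<in> {0, 1}"
    using a b unfolding symbolic_orbit_def by blast+
  moreover have "a t = 0 \<longleftrightarrow> b t = 0"
  proof (cases "wall ((tent ^^ t) p)")
    case False
    have "(tent ^^ t) p \<in> (if a t = 0 then Gamma0 n else Gamma1 n)"
      "(tent ^^ t) p \<in> (if b t = 0 then Gamma0 n else Gamma1 n)"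
      using a b unfolding symbolic_orbit_def by blast+
    then show ?thesis
      using False by (auto simp: Gamma0_def Gamma1_def wall_def split: if_splits)
  qed (rule wall)
  ultimately show "a t = b t" by auto
qed

theorem theorem3p2:
  fixes n :: nat and p :: "real list"
  assumes "n \<ge> 1"
    and "p \<in> Gamma n"
  shows "finite {a. symbolic_orbit n p a} \<and>
    card {a. symbolic_orbit n p a} \<le> 2 ^ (n * (n + 1) div 2)"
proof -
  define W where "W = {t. wall ((tent ^^ t) p)}"
  have W: "finite W" "card W \<le> n * (n + 1) div 2"
    using wall_visits[OF assms] by (simp_all add: W_def)
  \<comment> \<open>The free choices of a symbolic orbit, encoded as a subset of
    \<open>W\<close>.\<close>
  define zeros where "zeros a = {t \<in> W. a t = 0}" for a :: "nat \<Rightarrow> nat"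
  have inj: "inj_on zeros {a. symbolic_orbit n p a}"
    by (rule inj_onI) (auto simp: zeros_def W_def set_eq_iff intro: symbolic_orbit_eqI)
  have sub: "zeros ` {a. symbolic_orbit n p a} \<subseteq> Pow W"
    by (auto simp: zeros_def)
  have "card {a. symbolic_orbit n p a} \<le> card (Pow W)"
    by (rule card_inj_on_le[OF inj sub]) (simp add: W)
  also have "\<dots> \<le> 2 ^ (n * (n + 1) div 2)"
    using W by (simp add: card_Pow)
  finally show ?thesis
    using inj_on_finite[OF inj sub] W by simp
qed

end
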